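(* For any integers $k\ge1$ and $n>k$, the tight guarantee for oblivious static threshold algorithms relative to the prophet satisfies $$\alpha^{\mathsf{OST}/\mathsf{Proph}}_{k,n}=\inf_{\mathbf G}\sup_{J,\rho}\mathrm{innerLP}^{\mathsf{OST}(J,\rho)/\mathsf{Proph}}_{k,n}(\mathbf G),$$ and the tight guarantee relative to the ex-ante relaxation satisfies $$\alpha^{\mathsf{OST}/\mathsf{ExAnte}}_{k,n}=\inf_{\mathbf G}\sup_{J,\rho}\mathrm{innerLP}^{\mathsf{OST}(J,\rho)/\mathsf{ExAnte}}_{k,n}(\mathbf G),$$ where the infima are over all type distributions $\mathbf G$ for $n$ agents (with any finite number $m$ of types) and the suprema over $J\in[m]$, $\rho\in(0,1]$.
   Context: $[n]=\{1,\dots,n\}$. $\mathrm{Ber}(p)$ is a Bernoulli random variable with mean $p$, independent within sums. Type distributions $\mathbf G$: a positive integer $m$ (number of types) and numbers $G_{ij}$, $i\in[n]$, $j\in\{0,\dots,m\}$, with $0=G_{i0}\le G_{i1}\le\cdots\le G_{im}=1$ for every $i$; put $p_{ij}=G_{ij}-G_{i,j-1}$. Valuations: $r_1\ge\cdots\ge r_m\ge0$, not all zero. Agents $i=1,\dots,n$ arrive in this order; agent $i$ independently has type $j$ with probability $p_{ij}$, and then valuation $R_i=r_j$. There are $k$ slots. Static threshold policy $(J,\rho)$: while slots remain, it accepts each arriving agent of type $j<J$, accepts each arriving agent of type exactly $J$ according to an independent coin flip of probability $\rho$, and rejects all others. $\mathsf{ALG}_{J,\rho}(\mathbf G,r)$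 is the expected total valuation of the agents it accepts. Benchmarks: $\mathsf{Proph}(\mathbf G,r)=\mathbb E[\max_{S\subseteq[n],|S|\le k}\sum_{i\in S}R_i]$, $\mathsf{ExAnte}(\mathbf G,r)=\max\{\sum_{j=1}^m r_ja_j:\ \sum_{j=1}^m a_j\le k,\ 0\le a_j\le\sum_{i=1}^np_{ij}\ \forall j\in[m]\}$. An oblivious static threshold algorithm chooses $(J,\rho)$ knowing $\mathbf G$ but not the valuations. Tight guarantees: $$\alpha^{\mathsf{OST}/\mathsf{Proph}}_{k,n}=\inf_{\mathbf G}\sup_{J,\rho}\inf_{r}\frac{\mathsf{ALG}_{J,\rho}(\mathbf G,r)}{\mathsf{Proph}(\mathbf G,r)},\qquad \alpha^{\mathsf{OST}/\mathsf{ExAnte}}_{k,n}=\inf_{\mathbf G}\sup_{J,\rho}\inf_{r}\frac{\mathsf{ALG}_{J,\rho}(\mathbf G,r)}{\mathsf{ExAnte}(\mathbf G,r)},$$ with $\inf_r$ over valuations for which the denominator is positive. $\mathrm{innerLP}^{\mathsf{OST}(J,\rho)/\mathsf{Proph}}_{k,n}(\mathbf G)$ (resp. $/\mathsf{ExAnte}$) is the optimal value of: maximize $\theta$ over real $\theta,x^l_i,y^l_i$ ($i\in[n],l\in[k]$) subject to $$\theta\cdot Q_j\le\sum_{i=1}^n\sum_{l=1}^k\min\{y^l_i,G_{ij}x^l_i\}\ \ \forall j\in[m];\qquad 0\le y^l_i\le x^l_i,\quad y^l_i=((1-\rho)G_{i,J-1}+\rho G_{iJ})x^l_i\ \ \forall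 i,l;$$ $x^k_1=1$; $x^l_1=0$ for $l<k$; $x^l_i=x^l_{i-1}-y^l_{i-1}+y^{l+1}_{i-1}$ for $i>1$, $l\in[k]$ (with $y^{k+1}_i=0$), where $Q_j=\mathbb E[\min\{\sum_{i=1}^n\mathrm{Ber}(G_{ij}),k\}]$ (resp. $Q_j=\min\{\sum_{i=1}^nG_{ij},k\}$). *)

theory Defs
  imports "HOL-Probability.Probability" "HOL-Probability.Product_PMF"
begin

text \<open>
  Agents are \<open>1..n\<close> and types are \<open>1..m\<close>; \<open>G i j\<close> is the probability that agent \<open>i\<close> has a type
  in \<open>{1..j}\<close>. Values of \<open>G\<close> and \<open>r\<close> outside these index ranges are irrelevant. Outermost infima,
  suprema and LP values are taken in the complete lattice \<^typ>\<open>ereal\<close>, so that they carry no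
  boundedness side conditions.
\<close>

definition type_distribution :: "nat \<Rightarrow> nat \<Rightarrow> (nat \<Rightarrow> nat \<Rightarrow> real) \<Rightarrow> bool" where
  "type_distribution n m G \<longleftrightarrow> 1 \<le> m \<and>
     (\<forall>i\<in>{1..n}. G i 0 = 0 \<and> (\<forall>j\<in>{1..m}. G i (j - 1) \<le> G i j) \<and> G i m = 1)"

definition type_prob :: "(nat \<Rightarrow> nat \<Rightarrow> real) \<Rightarrow> nat \<Rightarrow> nat \<Rightarrow> real" where
  "type_prob G i j = G i j - G i (j - 1)"

definition valuation :: "nat \<Rightarrow> (nat \<Rightarrow> real) \<Rightarrow> bool" where
  "valuation m r \<longleftrightarrow>
     (\<forall>j\<in>{1..m}. 0 \<le> r j) \<and>
     (\<forall>j\<in>{1..m}. \<forall>j'\<in>{1..m}. j \<le> j' \<longrightarrow> r j' \<le> r j) \<and>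
     (\<exists>j\<in>{1..m}. r j \<noteq> 0)"

definition type_pmf :: "nat \<Rightarrow> (nat \<Rightarrow> nat \<Rightarrow> real) \<Rightarrow> nat \<Rightarrow> nat pmf" where
  "type_pmf m G i = embed_pmf (\<lambda>j. if j \<in> {1..m} then type_prob G i j else 0)"

lemma sum_type_prob:
  assumes "type_distribution n m G" and "i \<in> {1..n}"
  shows "(\<Sum>j = 1..m. type_prob G i j) = 1"
proof -
  have "(\<Sum>j = 1..k. type_prob G i j) = G i k - G i 0" for k
    by (induction k) (simp_all add: type_prob_def)
  with assms show ?thesis
    by (simp add: type_distribution_def)
qed

lemma pmf_type_pmf:
  assumes "type_distribution n m G" and "i \<in> {1..n}"
  shows "pmf (type_pmf m G i) j = (if j \<in> {1..m} then type_prob G i j else 0)"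
  unfolding type_pmf_def
proof (rule pmf_embed_pmf)
  let ?f = "\<lambda>j. if j \<in> {1..m} then type_prob G i j else 0"
  show nonneg: "0 \<le> ?f j" for j
    using assms by (auto simp: type_distribution_def type_prob_def)
  have "(\<integral>\<^sup>+ j. ennreal (?f j) \<partial>count_space UNIV) = (\<Sum>j = 1..m. ennreal (?f j))"
    by (rule nn_integral_count_space'[where A = "{1..m}"]) auto
  also have "\<dots> = ennreal (\<Sum>j = 1..m. ?f j)"
    using nonneg by (intro sum_ennreal) blast
  also have "(\<Sum>j = 1..m. ?f j) = 1"
    using sum_type_prob[OF assms] by simp
  finally show "(\<integral>\<^sup>+ j. ennreal (?f j) \<partial>count_space UNIV) = 1"
    by simp
qed

definition types_pmf :: "nat \<Rightarrow> nat \<Rightarrow> (nat \<Rightarrow> nat \<Rightarrow> real) \<Rightarrow> (nat \<Rightarrow> nat) pmf" where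
  "types_pmf n m G = Pi_pmf {1..n} 0 (type_pmf m G)"

definition coins_pmf :: "nat \<Rightarrow> real \<Rightarrow> (nat \<Rightarrow> bool) pmf" where
  "coins_pmf n \<rho> = Pi_pmf {1..n} False (\<lambda>_. bernoulli_pmf \<rho>)"

text \<open>
  \<open>accepted k J t c i\<close> is the set of agents among the first \<open>i\<close> accepted by the static threshold
  policy when agent \<open>a\<close> has type \<open>t a\<close> and coin \<open>c a\<close>. A coin is drawn for every agent but it is
  only consulted for agents of type exactly \<open>J\<close>.
\<close>

fun accepted :: "nat \<Rightarrow> nat \<Rightarrow> (nat \<Rightarrow> nat) \<Rightarrow> (nat \<Rightarrow> bool) \<Rightarrow> nat \<Rightarrow> nat set" where
  "accepted k J t c 0 = {}"
| "accepted k J t c (Suc i) =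
     (let A = accepted k J t c i in
      if card A < k \<and> (t (Suc i) < J \<or> t (Suc i) = J \<and> c (Suc i)) then insert (Suc i) A else A)"

definition ALG ::
  "nat \<Rightarrow> nat \<Rightarrow> nat \<Rightarrow> (nat \<Rightarrow> nat \<Rightarrow> real) \<Rightarrow> nat \<Rightarrow> real \<Rightarrow> (nat \<Rightarrow> real) \<Rightarrow> real" where
  "ALG k n m G J \<rho> r =
     measure_pmf.expectation (pair_pmf (types_pmf n m G) (coins_pmf n \<rho>))
       (\<lambda>(t, c). \<Sum>i\<in>accepted k J t c n. r (t i))"

definition Proph ::
  "nat \<Rightarrow> nat \<Rightarrow> nat \<Rightarrow> (nat \<Rightarrow> nat \<Rightarrow> real) \<Rightarrow> (nat \<Rightarrow> real) \<Rightarrow> real" where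
  "Proph k n m G r =
     measure_pmf.expectation (types_pmf n m G)
       (\<lambda>t. Max ((\<lambda>S. \<Sum>i\<in>S. r (t i)) ` {S. S \<subseteq> {1..n} \<and> card S \<le> k}))"

definition ex_ante_values ::
  "nat \<Rightarrow> nat \<Rightarrow> nat \<Rightarrow> (nat \<Rightarrow> nat \<Rightarrow> real) \<Rightarrow> (nat \<Rightarrow> real) \<Rightarrow> real set" where
  "ex_ante_values k n m G r =
     {(\<Sum>j = 1..m. r j * a j) | a :: nat \<Rightarrow> real.
        (\<Sum>j = 1..m. a j) \<le> real k \<and>
        (\<forall>j\<in>{1..m}. 0 \<le> a j \<and> a j \<le> (\<Sum>i = 1..n. type_prob G i j))}"

definition ExAnte ::
  "nat \<Rightarrow> nat \<Rightarrow> nat \<Rightarrow> (nat \<Rightarrow> nat \<Rightarrow> real) \<Rightarrow> (nat \<Rightarrow> real) \<Rightarrow> real" where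
  "ExAnte k n m G r = Sup (ex_ante_values k n m G r)"

text \<open>The supremum in \<^const>\<open>ExAnte\<close> is over a nonempty bounded set, hence not a default value.\<close>

lemma ex_ante_values_nonempty:
  assumes "type_distribution n m G"
  shows "0 \<in> ex_ante_values k n m G r"
  unfolding ex_ante_values_def
  by (rule CollectI, rule exI[of _ "\<lambda>_. 0"])
     (use assms in \<open>auto simp: type_distribution_def type_prob_def intro!: sum_nonneg\<close>)

lemma bdd_above_ex_ante_values:
  assumes "valuation m r"
  shows "bdd_above (ex_ante_values k n m G r)"
proof (rule bdd_aboveI)
  fix v assume "v \<in> ex_ante_values k n m G r"
  then show "v \<le> (\<Sum>j = 1..m. r j * (\<Sum>i = 1..n. type_prob G i j))"
    using assms unfolding ex_ante_values_def valuation_def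
    by (auto intro!: sum_mono mult_left_mono)
qed

definition OST_guarantee ::
  "(nat \<Rightarrow> nat \<Rightarrow> nat \<Rightarrow> (nat \<Rightarrow> nat \<Rightarrow> real) \<Rightarrow> (nat \<Rightarrow> real) \<Rightarrow> real) \<Rightarrow> nat \<Rightarrow> nat \<Rightarrow> ereal" where
  "OST_guarantee B k n =
     (INF (m, G)\<in>{(m, G). type_distribution n m G}.
        SUP (J, \<rho>)\<in>{1..m} \<times> {0<..1}.
          INF r\<in>{r. valuation m r \<and> 0 < B k n m G r}. ereal (ALG k n m G J \<rho> r / B k n m G r))"

definition Q_Proph :: "nat \<Rightarrow> nat \<Rightarrow> (nat \<Rightarrow> nat \<Rightarrow> real) \<Rightarrow> nat \<Rightarrow> real" where
  "Q_Proph k n G j =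
     measure_pmf.expectation (Pi_pmf {1..n} False (\<lambda>i. bernoulli_pmf (G i j)))
       (\<lambda>b. min (\<Sum>i = 1..n. of_bool (b i)) (real k))"

definition Q_ExAnte :: "nat \<Rightarrow> nat \<Rightarrow> (nat \<Rightarrow> nat \<Rightarrow> real) \<Rightarrow> nat \<Rightarrow> real" where
  "Q_ExAnte k n G j = min (\<Sum>i = 1..n. G i j) (real k)"

text \<open>Below, \<open>x i l\<close> and \<open>y i l\<close> stand for $x^l_i$ and $y^l_i$.\<close>

definition innerLP_feasible ::
  "(nat \<Rightarrow> nat \<Rightarrow> (nat \<Rightarrow> nat \<Rightarrow> real) \<Rightarrow> nat \<Rightarrow> real) \<Rightarrow> nat \<Rightarrow> nat \<Rightarrow> nat \<Rightarrow> (nat \<Rightarrow> nat \<Rightarrow> real) \<Rightarrow>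
   nat \<Rightarrow> real \<Rightarrow> real \<Rightarrow> (nat \<Rightarrow> nat \<Rightarrow> real) \<Rightarrow> (nat \<Rightarrow> nat \<Rightarrow> real) \<Rightarrow> bool" where
  "innerLP_feasible Q k n m G J \<rho> \<theta> x y \<longleftrightarrow>
     (\<forall>j\<in>{1..m}. \<theta> * Q k n G j \<le> (\<Sum>i = 1..n. \<Sum>l = 1..k. min (y i l) (G i j * x i l))) \<and>
     (\<forall>i\<in>{1..n}. \<forall>l\<in>{1..k}. 0 \<le> y i l \<and> y i l \<le> x i l \<and>
        y i l = ((1 - \<rho>) * G i (J - 1) + \<rho> * G i J) * x i l) \<and>
     x 1 k = 1 \<and>
     (\<forall>l\<in>{1..<k}. x 1 l = 0) \<and>
     (\<forall>i\<in>{2..n}. \<forall>l\<in>{1..k}.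
        x i l = x (i - 1) l - y (i - 1) l + (if l < k then y (i - 1) (l + 1) else 0))"

definition innerLP ::
  "(nat \<Rightarrow> nat \<Rightarrow> (nat \<Rightarrow> nat \<Rightarrow> real) \<Rightarrow> nat \<Rightarrow> real) \<Rightarrow> nat \<Rightarrow> nat \<Rightarrow> nat \<Rightarrow> (nat \<Rightarrow> nat \<Rightarrow> real) \<Rightarrow>
   nat \<Rightarrow> real \<Rightarrow> ereal" where
  "innerLP Q k n m G J \<rho> = (SUP \<theta>\<in>{\<theta>. \<exists>x y. innerLP_feasible Q k n m G J \<rho> \<theta> x y}. ereal \<theta>)"

end

theory Submission
  imports Defs
begin

text \<open>
  The two sides agree already for fixed \<open>G\<close>, \<open>J\<close> and \<open>\<rho>\<close>. The constraints of the inner LP determine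
  \<open>x\<close> and \<open>y\<close>: \<open>x i l\<close> is the probability that \<open>l\<close> slots are free when agent \<open>i\<close> arrives. Hence the
  right-hand side of its \<open>j\<close>-th constraint is the expected number \<open>A j\<close> of accepted agents of type at
  most \<open>j\<close>, and the LP value is the minimum of \<open>A j / Q j\<close> over all \<open>j\<close> with \<open>Q j > 0\<close>. By Abel
  summation, the performance of the policy and the benchmark are the combinations of the \<open>A j\<close> and
  of the \<open>Q j\<close> with the same nonnegative coefficients \<open>r j - r (j + 1)\<close>. So their ratio is at least
  that minimum, which is attained by the valuation that is 1 on types up to some \<open>j\<close> and 0 beyond.
\<close>

section \<open>Abel summation over type prefixes\<close>

definition value_step :: "nat \<Rightarrow> (nat \<Rightarrow> real) \<Rightarrow> nat \<Rightarrow> real" where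
  "value_step m r j = r j - (if j < m then r (Suc j) else 0)"

lemma value_step_nonneg:
  assumes "valuation m r" "j \<in> {1..m}"
  shows "0 \<le> value_step m r j"
  using assms by (auto simp: value_step_def valuation_def)

text \<open>Telescoping: only the steps at \<open>j \<ge> t\<close> survive. Since
  \<open>r (Suc m)\<close> is arbitrary, the step at \<open>m\<close> is \<open>r m\<close> itself,
  which closes the telescope exactly.\<close>

lemma value_eq_sum_value_step:
  assumes "t \<in> {1..m}"
  shows "r t = (\<Sum>j = 1..m. value_step m r j * of_bool (t \<le> j))"
proof -
  have "t \<le> m" using assms by simp
  then have "(\<Sum>j = t..m. value_step m r j) = r t"
    by (induction t rule: inc_induct)
       (simp_all add: value_step_def sum.atLeast_Suc_atMost)
  moreover have "(\<Sum>j = 1..m. value_step m r j * of_bool (t \<le> j)) = (\<Sum>j = t..m. value_step m r j)"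
    using assms by (intro sum.mono_neutral_cong_right) auto
  ultimately show ?thesis by simp
qed

text \<open>The weights \<open>c\<close> let one identity serve two purposes: with weight 1 it
  counts agents of type at most \<open>j\<close>, and with \<open>S\<close> the set of types and
  \<open>t\<close> the identity it is Abel summation of a fractional allocation.\<close>

lemma sum_value_eq_sum_value_step:
  assumes "\<And>i. i \<in> S \<Longrightarrow> t i \<in> {1..m}"
  shows "(\<Sum>i\<in>S. r (t i) * c i) =
    (\<Sum>j = 1..m. value_step m r j * (\<Sum>i\<in>S. of_bool (t i \<le> j) * c i))"
proof -
  have "(\<Sum>i\<in>S. r (t i) * c i) =
      (\<Sum>i\<in>S. \<Sum>j = 1..m. value_step m r j * (of_bool (t i \<le> j) * c i))"
  proof (intro sum.cong refl)
    fix i assume "i \<in> S"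
    then have "r (t i) = (\<Sum>j = 1..m. value_step m r j * of_bool (t i \<le> j))"
      by (intro value_eq_sum_value_step assms)
    then show "r (t i) * c i = (\<Sum>j = 1..m. value_step m r j * (of_bool (t i \<le> j) * c i))"
      by (simp only: sum_distrib_right mult.assoc)
  qed
  then show ?thesis
    by (simp add: sum_distrib_left sum.swap[of _ S])
qed

lemma sum_value_eq_card:
  assumes "finite S" "\<And>i. i \<in> S \<Longrightarrow> t i \<in> {1..m}"
  shows "(\<Sum>i\<in>S. r (t i)) = (\<Sum>j = 1..m. value_step m r j * card {i\<in>S. t i \<le> j})"
proof -
  have "(\<Sum>i\<in>S. of_bool (t i \<le> j)) = real (card {i\<in>S. t i \<le> j})" for j
    using assms(1) by (simp add: sum.If_cases of_bool_def Int_def)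
  then show ?thesis
    using sum_value_eq_sum_value_step[of S t m r "\<lambda>_. 1"] assms(2) by simp
qed

section \<open>The best selection in hindsight\<close>

text \<open>Filling the \<open>k\<close> places in order of type maximizes all prefix counts
  simultaneously. The induction enlarges the selection for types up to \<open>m\<close> by agents of
  type \<open>Suc m\<close>, as far as capacity permits.\<close>

lemma ex_greedy_selection:
  fixes t :: "'a \<Rightarrow> nat"
  assumes "finite N"
  shows "\<exists>S. S \<subseteq> {i\<in>N. t i \<le> m} \<and> card S \<le> k \<and>
    (\<forall>j\<le>m. card {i\<in>S. t i \<le> j} = min (card {i\<in>N. t i \<le> j}) k)"
proof (induction m)
  case 0
  obtain S where S: "S \<subseteq> {i\<in>N. t i \<le> 0}" "card S = min (card {i\<in>N. t i \<le> 0}) k"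
    using obtain_subset_with_card_n[OF min.cobounded1[of "card {i\<in>N. t i \<le> 0}" k]]
    by metis
  moreover have "{i\<in>S. t i \<le> 0} = S"
    using S by auto
  ultimately show ?case by (intro exI[of _ S]) simp
next
  case (Suc m)
  then obtain S where S: "S \<subseteq> {i\<in>N. t i \<le> m}" "card S \<le> k"
    "\<forall>j\<le>m. card {i\<in>S. t i \<le> j} = min (card {i\<in>N. t i \<le> j}) k"
    by (elim exE conjE)
  let ?M = "{i\<in>N. t i \<le> Suc m}"
  have "{i\<in>S. t i \<le> m} = S" using S(1) by auto
  then have cS: "card S = min (card {i\<in>N. t i \<le> m}) k" using S(3) by auto
  have sub: "S \<subseteq> ?M" using S(1) by auto
  have "card S \<le> min (card ?M) k"
    using S(2) card_mono[OF _ sub] assms by simp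
  then obtain T where T: "S \<subseteq> T" "T \<subseteq> ?M" "card T = min (card ?M) k"
    using exists_subset_between[of S "min (card ?M) k" ?M] assms sub by auto
  have fT: "finite T" using T(2) assms by (auto intro: finite_subset)
  have "card {i\<in>T. t i \<le> j} = min (card {i\<in>N. t i \<le> j}) k" if "j \<le> Suc m" for j
  proof (cases "j = Suc m")
    case True
    then have "{i\<in>T. t i \<le> j} = T" using T(2) by auto
    then show ?thesis using T True by simp
  next
    case False
    then have j: "j \<le> m" using that by simp
    show ?thesis
    \<comment> \<open>Either \<open>S\<close> already fills all \<open>k\<close> places and nothing
      is added, or \<open>S\<close> contains every agent of type at most \<open>m\<close>, so that
      smaller prefixes of \<open>T\<close> and \<open>N\<close> coincide.\<close>
    proof (cases "k \<le> card {i\<in>N. t i \<le> m}")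
      case True
      then have "T = S"
        using T fT cS by (metis card_subset_eq min.absorb2 min.cobounded2 card_mono le_antisym)
      then show ?thesis using S(3) j by simp
    next
      case False
      then have "S = {i\<in>N. t i \<le> m}"
        using cS S(1) assms by (intro card_subset_eq) auto
      then have "{i\<in>T. t i \<le> j} = {i\<in>N. t i \<le> j}"
        using T(1,2) j by auto
      moreover have "card {i\<in>N. t i \<le> j} \<le> card {i\<in>N. t i \<le> m}"
        using assms j by (intro card_mono) auto
      ultimately show ?thesis using False by simp
    qed
  qed
  with T show ?case by (intro exI[of _ T]) simp
qed

text \<open>No selection has more than \<open>min (card {i\<in>N. t i \<le> j}) k\<close> agents of
  type at most \<open>j\<close>, and the steps of \<open>r\<close> are nonnegative. The greedy
  selection meets all these bounds at once, so it is optimal for every valuation.\<close>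

lemma Max_selection_value:
  assumes "finite N" "\<And>i. i \<in> N \<Longrightarrow> t i \<in> {1..m}" "valuation m r"
  shows "Max ((\<lambda>S. \<Sum>i\<in>S. r (t i)) ` {S. S \<subseteq> N \<and> card S \<le> k}) =
    (\<Sum>j = 1..m. value_step m r j * real (min (card {i\<in>N. t i \<le> j}) k))"
    (is "Max (?f ` ?A) = ?v")
proof (rule Max_eqI)
  show "finite (?f ` ?A)" using assms(1) by simp
next
  fix v assume "v \<in> ?f ` ?A"
  then obtain S where S: "S \<subseteq> N" "card S \<le> k" "v = ?f S" by auto
  have fS: "finite S" using S assms(1) finite_subset by blast
  have "v = (\<Sum>j = 1..m. value_step m r j * card {i\<in>S. t i \<le> j})"
    unfolding S(3) using S(1) fS assms(2) by (intro sum_value_eq_card) auto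
  also have "\<dots> \<le> ?v"
  proof (intro sum_mono mult_left_mono)
    fix j
    have "card {i\<in>S. t i \<le> j} \<le> card {i\<in>N. t i \<le> j}"
      using assms(1) S(1) by (intro card_mono) auto
    moreover have "card {i\<in>S. t i \<le> j} \<le> card S"
      using fS by (intro card_mono) auto
    ultimately show "real (card {i\<in>S. t i \<le> j}) \<le> real (min (card {i\<in>N. t i \<le> j}) k)"
      using S(2) by simp
  qed (use assms value_step_nonneg in auto)
  finally show "v \<le> ?v" .
next
  obtain S where S: "S \<subseteq> {i\<in>N. t i \<le> m}" "card S \<le> k"
    "\<And>j. j \<le> m \<Longrightarrow> card {i\<in>S. t i \<le> j} = min (card {i\<in>N. t i \<le> j}) k"
    using ex_greedy_selection[OF assms(1), of t m k] by auto
  have fS: "finite S" using S assms(1) by (auto intro: finite_subset)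
  have "?f S = (\<Sum>j = 1..m. value_step m r j * card {i\<in>S. t i \<le> j})"
    using S(1) fS assms(2) by (intro sum_value_eq_card) auto
  also have "\<dots> = ?v" using S(3) by simp
  finally show "?v \<in> ?f ` ?A" using S(1,2) by (intro image_eqI[of _ _ S]) auto
qed

section \<open>Finite expectations, agent types and the two benchmarks\<close>

lemma expectation_pair_pmf_mult:
  fixes f :: "'a \<Rightarrow> real" and g :: "'b \<Rightarrow> real"
  assumes "finite (set_pmf p)" "finite (set_pmf q)"
  shows "measure_pmf.expectation (pair_pmf p q) (\<lambda>z. f (fst z) * g (snd z)) =
    measure_pmf.expectation p f * measure_pmf.expectation q g"
proof -
  have "measure_pmf.expectation (pair_pmf p q) (\<lambda>z. f (fst z) * g (snd z)) =
    (\<Sum>z\<in>set_pmf p \<times> set_pmf q. pmf (pair_pmf p q) z * (f (fst z) * g (snd z)))"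
    using assms by (subst integral_measure_pmf[of "set_pmf p \<times> set_pmf q"]) auto
  also have "\<dots> = (\<Sum>x\<in>set_pmf p. pmf p x * f x) * (\<Sum>y\<in>set_pmf q. pmf q y * g y)"
    unfolding sum_product sum.cartesian_product
    by (intro sum.cong) (auto simp: pmf_pair mult_ac)
  also have "\<dots> = measure_pmf.expectation p f * measure_pmf.expectation q g"
    using assms by (simp add: integral_measure_pmf[of "set_pmf p"] integral_measure_pmf[of "set_pmf q"])
  finally show ?thesis .
qed

locale typed_agents =
  fixes n m :: nat and G :: "nat \<Rightarrow> nat \<Rightarrow> real"
  assumes distribution: "type_distribution n m G"
begin

lemma types_pos: "1 \<le> m"
  using distribution by (simp add: type_distribution_def)

lemma G_mono:
  assumes "i \<in> {1..n}" "j \<le> j'" "j' \<le> m"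
  shows "G i j \<le> G i j'"
  using assms(2,3)
proof (induction j' rule: dec_induct)
  case (step q)
  have "Suc q \<in> {1..m}" using step by auto
  then have "G i (Suc q - 1) \<le> G i (Suc q)"
    using distribution assms(1) unfolding type_distribution_def by blast
  with step show ?case by auto
qed simp

lemma G_0: "i \<in> {1..n} \<Longrightarrow> G i 0 = 0" and G_m: "i \<in> {1..n} \<Longrightarrow> G i m = 1"
  using distribution by (auto simp: type_distribution_def)

lemma G_nonneg: "i \<in> {1..n} \<Longrightarrow> j \<le> m \<Longrightarrow> 0 \<le> G i j"
  and G_le_1: "i \<in> {1..n} \<Longrightarrow> j \<le> m \<Longrightarrow> G i j \<le> 1"
  using G_mono[of i 0 j] G_mono[of i j m] by (auto simp: G_0 G_m)

lemma set_type_pmf: "i \<in> {1..n} \<Longrightarrow> set_pmf (type_pmf m G i) \<subseteq> {1..m}"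
  by (rule subsetI) (simp add: set_pmf_iff pmf_type_pmf[OF distribution] split: if_splits)

lemma sum_type_prob_prefix: "i \<in> {1..n} \<Longrightarrow> (\<Sum>j = 1..q. type_prob G i j) = G i q"
  by (induction q) (simp_all add: type_prob_def G_0)

lemma expectation_type_pmf:
  fixes f :: "nat \<Rightarrow> real"
  assumes "i \<in> {1..n}"
  shows "measure_pmf.expectation (type_pmf m G i) f = (\<Sum>j = 1..m. type_prob G i j * f j)"
  using set_type_pmf[OF assms] assms
  by (subst integral_measure_pmf[of "{1..m}"]) (auto simp: pmf_type_pmf[OF distribution])

lemma expectation_type_le:
  assumes "i \<in> {1..n}" "j \<le> m"
  shows "measure_pmf.expectation (type_pmf m G i) (\<lambda>a. of_bool (a \<le> j)) = G i j"
proof -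
  have "measure_pmf.expectation (type_pmf m G i) (\<lambda>a. of_bool (a \<le> j)) =
      (\<Sum>a = 1..m. type_prob G i a * of_bool (a \<le> j))"
    using assms(1) by (rule expectation_type_pmf)
  also have "\<dots> = (\<Sum>a = 1..j. type_prob G i a)"
    using assms(2) by (intro sum.mono_neutral_cong_right) auto
  finally show ?thesis using sum_type_prob_prefix assms by simp
qed

lemma types_pmf_range: "t \<in> set_pmf (types_pmf q m G) \<Longrightarrow> q \<le> n \<Longrightarrow> i \<in> {1..q} \<Longrightarrow> t i \<in> {1..m}"
  using set_type_pmf[of i] unfolding types_pmf_def set_Pi_pmf[OF finite_atLeastAtMost]
  by (fastforce simp: PiE_dflt_def)

lemma finite_types_pmf: "q \<le> n \<Longrightarrow> finite (set_pmf (types_pmf q m G))"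
  unfolding types_pmf_def set_Pi_pmf[OF finite_atLeastAtMost]
  by (intro finite_PiE_dflt) (auto intro: finite_subset[OF set_type_pmf])

text \<open>The event is \<open>a \<in> {1..j}\<close> rather than \<open>a \<le> j\<close> so that
  the default type 0 is sent to the default \<open>False\<close>, as is needed to map a whole
  \<open>Pi_pmf\<close> coordinatewise.\<close>

lemma map_type_pmf_bernoulli:
  assumes "i \<in> {1..n}" "j \<le> m"
  shows "map_pmf (\<lambda>a. a \<in> {1..j}) (type_pmf m G i) = bernoulli_pmf (G i j)"
proof -
  have "pmf (map_pmf (\<lambda>a. a \<in> {1..j}) (type_pmf m G i)) True =
      measure_pmf.expectation (type_pmf m G i) (indicator {1..j})"
    by (simp add: pmf_map vimage_def atLeastAtMost_def atLeast_def atMost_def Int_def)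
  also have "\<dots> = measure_pmf.expectation (type_pmf m G i) (\<lambda>a. of_bool (a \<le> j))"
    using set_type_pmf[OF assms(1)]
    by (intro integral_cong_AE) (auto simp: AE_measure_pmf_iff indicator_def)
  also have "\<dots> = G i j"
    using assms by (rule expectation_type_le)
  finally have T: "pmf (map_pmf (\<lambda>a. a \<in> {1..j}) (type_pmf m G i)) True = G i j" .
  then have "pmf (map_pmf (\<lambda>a. a \<in> {1..j}) (type_pmf m G i)) False = 1 - G i j"
    by (simp add: pmf_False_conv_True)
  with T show ?thesis
    using G_nonneg[OF assms] G_le_1[OF assms] by (intro pmf_eqI) (metis (full_types) pmf_bernoulli_False pmf_bernoulli_True)
qed

text \<open>Coupling: the independent Bernoulli variables are realized as the indicators that the
  agents have type at most \<open>j\<close>.\<close>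

lemma Q_Proph_eq:
  assumes "j \<le> m"
  shows "Q_Proph k n G j =
    measure_pmf.expectation (types_pmf n m G) (\<lambda>t. real (min (card {i\<in>{1..n}. t i \<le> j}) k))"
proof -
  have "Pi_pmf {1..n} False (\<lambda>i. bernoulli_pmf (G i j)) =
      Pi_pmf {1..n} False (\<lambda>i. map_pmf (\<lambda>a. a \<in> {1..j}) (type_pmf m G i))"
    using assms by (intro Pi_pmf_cong) (auto simp only: map_type_pmf_bernoulli)
  also have "\<dots> = map_pmf (\<lambda>t. (\<lambda>a. a \<in> {1..j}) \<circ> t) (types_pmf n m G)"
    unfolding types_pmf_def by (rule Pi_pmf_map) auto
  finally have "Q_Proph k n G j = measure_pmf.expectation (types_pmf n m G)
      (\<lambda>t. min (\<Sum>i = 1..n. of_bool (t i \<in> {1..j})) (real k))"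
    by (simp add: Q_Proph_def o_def)
  also have "\<dots> = measure_pmf.expectation (types_pmf n m G)
      (\<lambda>t. real (min (card {i\<in>{1..n}. t i \<le> j}) k))"
  \<comment> \<open>The two indicators differ at type 0, which lies outside the support.\<close>
  proof (intro integral_cong_AE)
    show "AE t in types_pmf n m G. min (\<Sum>i = 1..n. of_bool (t i \<in> {1..j})) (real k) =
        real (min (card {i\<in>{1..n}. t i \<le> j}) k)"
    proof (rule AE_pmfI)
      fix t assume "t \<in> set_pmf (types_pmf n m G)"
      then have "(\<Sum>i = 1..n. of_bool (t i \<in> {1..j})) = (\<Sum>i = 1..n. of_bool (t i \<le> j) :: real)"
        using types_pmf_range[of t n] by (intro sum.cong) auto
      also have "\<dots> = real (card {i\<in>{1..n}. t i \<le> j})"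
        by (simp add: sum.If_cases of_bool_def Int_def)
      finally show "min (\<Sum>i = 1..n. of_bool (t i \<in> {1..j})) (real k) =
        real (min (card {i\<in>{1..n}. t i \<le> j}) k)"
        by simp
    qed
  qed auto
  finally show ?thesis .
qed

lemma Proph_eq:
  assumes "valuation m r"
  shows "Proph k n m G r = (\<Sum>j = 1..m. value_step m r j * Q_Proph k n G j)"
proof -
  have "Proph k n m G r = measure_pmf.expectation (types_pmf n m G)
      (\<lambda>t. \<Sum>j = 1..m. value_step m r j * real (min (card {i\<in>{1..n}. t i \<le> j}) k))"
    unfolding Proph_def
  proof (intro integral_cong_AE AE_pmfI)
    fix t assume "t \<in> set_pmf (types_pmf n m G)"
    then show "Max ((\<lambda>S. \<Sum>i\<in>S. r (t i)) ` {S. S \<subseteq> {1..n} \<and> card S \<le> k}) =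
        (\<Sum>j = 1..m. value_step m r j * real (min (card {i\<in>{1..n}. t i \<le> j}) k))"
      using assms types_pmf_range[of t n] by (intro Max_selection_value) auto
  qed auto
  also have "\<dots> = (\<Sum>j = 1..m. value_step m r j * Q_Proph k n G j)"
    using finite_types_pmf
    by (subst Bochner_Integration.integral_sum)
       (auto simp: Q_Proph_eq integrable_measure_pmf_finite intro!: sum.cong)
  finally show ?thesis .
qed

text \<open>After Abel summation the objective depends on the prefix sums of \<open>a\<close>. Each
  is bounded both by the expected number of agents of type at most \<open>j\<close> and by
  \<open>k\<close>, hence by \<open>Q_ExAnte\<close>; one allocation attains all bounds, so the
  supremum is a maximum.\<close>

lemma ExAnte_eq:
  assumes "valuation m r"
  shows "ExAnte k n m G r = (\<Sum>j = 1..m. value_step m r j * Q_ExAnte k n G j)"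
  unfolding ExAnte_def
proof (rule cSup_eq_maximum)
  have telescope: "(\<Sum>j = 1..q. \<Sum>i = 1..n. type_prob G i j) = (\<Sum>i = 1..n. G i q)" for q
    by (subst sum.swap) (intro sum.cong refl sum_type_prob_prefix)
  have abel: "(\<Sum>j = 1..m. r j * a j) = (\<Sum>j = 1..m. value_step m r j * (\<Sum>i = 1..j. a i))" for a
  proof -
    have "(\<Sum>i = 1..m. of_bool (i \<le> j) * a i) = (\<Sum>i = 1..j. a i)" if "j \<in> {1..m}" for j
      using that by (intro sum.mono_neutral_cong_right) auto
    then show ?thesis
      using sum_value_eq_sum_value_step[of "{1..m}" "\<lambda>i. i" m r a] by simp
  qed
  {
    fix v assume "v \<in> ex_ante_values k n m G r"
    then obtain a where a: "v = (\<Sum>j = 1..m. r j * a j)" "(\<Sum>j = 1..m. a j) \<le> real k"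
      "\<And>j. j \<in> {1..m} \<Longrightarrow> 0 \<le> a j \<and> a j \<le> (\<Sum>i = 1..n. type_prob G i j)"
      unfolding ex_ante_values_def by auto
    show "v \<le> (\<Sum>j = 1..m. value_step m r j * Q_ExAnte k n G j)"
      unfolding a(1) abel
    proof (intro sum_mono mult_left_mono)
      fix j assume j: "j \<in> {1..m}"
      have "(\<Sum>i = 1..j. a i) \<le> (\<Sum>j = 1..j. \<Sum>i = 1..n. type_prob G i j)"
        using a(3) j by (intro sum_mono) auto
      moreover have "(\<Sum>i = 1..j. a i) \<le> (\<Sum>i = 1..m. a i)"
        using a(3) j by (intro sum_mono2) auto
      ultimately show "(\<Sum>i = 1..j. a i) \<le> Q_ExAnte k n G j"
        using a(2) unfolding telescope by (simp add: Q_ExAnte_def)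
    qed (use assms value_step_nonneg in auto)
  }
  \<comment> \<open>The greedy fractional allocation: its prefix sums are \<open>Q_ExAnte\<close>.
    Its entries respect the supply of each type because capping at \<open>k\<close> is monotone and
    never enlarges an increment.\<close>
  define a where "a j = Q_ExAnte k n G j - Q_ExAnte k n G (j - 1)" for j
  have a: "(\<Sum>i = 1..j. a i) = Q_ExAnte k n G j" for j
    by (induction j) (simp_all add: a_def Q_ExAnte_def G_0)
  have "0 \<le> a j \<and> a j \<le> (\<Sum>i = 1..n. type_prob G i j)" if "j \<in> {1..m}" for j
  proof -
    have "(\<Sum>i = 1..n. G i (j - 1)) \<le> (\<Sum>i = 1..n. G i j)"
      using that by (intro sum_mono G_mono) auto
    then show ?thesis
      unfolding a_def Q_ExAnte_def type_prob_def sum_subtractf by auto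
  qed
  moreover have "(\<Sum>i = 1..m. a i) \<le> real k"
    unfolding a by (simp add: Q_ExAnte_def)
  ultimately show "(\<Sum>j = 1..m. value_step m r j * Q_ExAnte k n G j) \<in> ex_ante_values k n m G r"
    unfolding ex_ante_values_def
    by (intro CollectI exI[of _ a] conjI ballI) (auto simp only: abel a)
qed

end

section \<open>The randomness of a threshold policy\<close>

locale threshold_policy = typed_agents +
  fixes k J :: nat and \<rho> :: real
  assumes J: "J \<in> {1..m}" and \<rho>: "\<rho> \<in> {0<..1}"
begin

text \<open>Willingness to accept regardless of free slots. It depends only on the current agent's
  type and coin, hence is independent of the past.\<close>

definition accepts :: "nat \<Rightarrow> bool \<Rightarrow> bool" where
  "accepts a b \<longleftrightarrow> a < J \<or> a = J \<and> b"

definition accept_prob :: "nat \<Rightarrow> real" where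
  "accept_prob i = (1 - \<rho>) * G i (J - 1) + \<rho> * G i J"

definition agent_pmf :: "nat \<Rightarrow> (nat \<times> bool) pmf" where
  "agent_pmf i = pair_pmf (type_pmf m G i) (bernoulli_pmf \<rho>)"

text \<open>Only the first \<open>q\<close> agents are drawn, which makes induction on
  \<open>q\<close> possible; \<open>run_pmf n\<close> is the distribution in
  \<open>ALG\<close>.\<close>

definition run_pmf :: "nat \<Rightarrow> ((nat \<Rightarrow> nat) \<times> (nat \<Rightarrow> bool)) pmf" where
  "run_pmf q = pair_pmf (types_pmf q m G) (coins_pmf q \<rho>)"

lemma accept_prob_bounds:
  assumes "i \<in> {1..n}"
  shows "G i (J - 1) \<le> accept_prob i" "accept_prob i \<le> G i J"
proof -
  have "G i (J - 1) \<le> G i J" using assms J by (intro G_mono) auto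
  then have "0 \<le> \<rho> * (G i J - G i (J - 1))" "0 \<le> (1 - \<rho>) * (G i J - G i (J - 1))"
    using \<rho> by auto
  then show "G i (J - 1) \<le> accept_prob i" "accept_prob i \<le> G i J"
    by (auto simp: accept_prob_def algebra_simps)
qed

lemma accept_prob_nonneg: "i \<in> {1..n} \<Longrightarrow> 0 \<le> accept_prob i"
  and accept_prob_le_1: "i \<in> {1..n} \<Longrightarrow> accept_prob i \<le> 1"
proof -
  assume i: "i \<in> {1..n}"
  have "J - 1 \<le> m" "J \<le> m" using J by auto
  then show "0 \<le> accept_prob i" "accept_prob i \<le> 1"
    using accept_prob_bounds[OF i] G_nonneg[OF i] G_le_1[OF i] by (meson order.trans)+
qed

lemma finite_agent_pmf: "i \<in> {1..n} \<Longrightarrow> finite (set_pmf (agent_pmf i))"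
  unfolding agent_pmf_def set_pair_pmf
  by (intro finite_cartesian_product) (auto intro: finite_subset[OF set_type_pmf])

lemma finite_run_pmf: "q \<le> n \<Longrightarrow> finite (set_pmf (run_pmf q))"
  unfolding run_pmf_def set_pair_pmf coins_pmf_def set_Pi_pmf[OF finite_atLeastAtMost]
  by (intro finite_cartesian_product finite_types_pmf finite_PiE_dflt)
     (auto intro: finite_subset[of _ UNIV])

lemma expectation_accepts:
  assumes "i \<in> {1..n}"
  shows "measure_pmf.expectation (agent_pmf i) (\<lambda>z. of_bool (accepts (fst z) (snd z))) = accept_prob i"
proof -
  \<comment> \<open>\<open>?f\<close> covers the types below \<open>J\<close>, which are accepted
    outright; \<open>?g\<close> is the indicator of type \<open>J\<close> times the coin, and
    factors by independence.\<close>
  let ?f = "\<lambda>z. of_bool (fst z \<le> J - 1) :: real"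
  let ?g = "\<lambda>z. (of_bool (fst z \<le> J) - of_bool (fst z \<le> J - 1)) * of_bool (snd z) :: real"
  have "of_bool (accepts (fst z) (snd z)) = ?f z + ?g z" for z
    using J by (cases z) (auto simp: accepts_def)
  then have "measure_pmf.expectation (agent_pmf i) (\<lambda>z. of_bool (accepts (fst z) (snd z))) =
      measure_pmf.expectation (agent_pmf i) ?f + measure_pmf.expectation (agent_pmf i) ?g"
    using finite_agent_pmf[OF assms] by (simp add: integrable_measure_pmf_finite)
  also have "measure_pmf.expectation (agent_pmf i) ?f = G i (J - 1)"
    unfolding agent_pmf_def
    by (subst expectation_pair_pmf_fst) (use J assms in \<open>auto simp: expectation_type_le\<close>)
  also have "measure_pmf.expectation (agent_pmf i) ?g = (G i J - G i (J - 1)) * \<rho>"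
  proof -
    have fin: "finite (set_pmf (type_pmf m G i))"
      using set_type_pmf[OF assms] by (rule finite_subset) simp
    have "measure_pmf.expectation (agent_pmf i) ?g =
        measure_pmf.expectation (type_pmf m G i) (\<lambda>a. of_bool (a \<le> J) - of_bool (a \<le> J - 1)) *
        measure_pmf.expectation (bernoulli_pmf \<rho>) of_bool"
      unfolding agent_pmf_def
      by (rule expectation_pair_pmf_mult) (use fin in \<open>auto intro: finite_subset[of _ UNIV]\<close>)
    also have "measure_pmf.expectation (bernoulli_pmf \<rho>) of_bool = \<rho>"
      using \<rho> by simp
    also have "measure_pmf.expectation (type_pmf m G i) (\<lambda>a. of_bool (a \<le> J) - of_bool (a \<le> J - 1)) =
        G i J - G i (J - 1)"
      using fin J assms by (auto simp: integrable_measure_pmf_finite expectation_type_le)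
    finally show ?thesis .
  qed
  finally show ?thesis by (simp add: accept_prob_def algebra_simps)
qed

text \<open>The events "accepted" and "type at most \<open>j\<close>" are nested, in a direction
  determined by whether \<open>J \<le> j\<close>. So their intersection has the smaller of the two
  probabilities, which is the origin of the minimum in the LP.\<close>

lemma expectation_accepts_le:
  assumes "i \<in> {1..n}" "j \<in> {1..m}"
  shows "measure_pmf.expectation (agent_pmf i) (\<lambda>z. of_bool (accepts (fst z) (snd z) \<and> fst z \<le> j)) =
    min (accept_prob i) (G i j)"
proof (cases "J \<le> j")
  case True
  then have "(accepts a b \<and> a \<le> j) = accepts a b" for a b
    by (auto simp: accepts_def)
  moreover have "accept_prob i \<le> G i j"
    using accept_prob_bounds(2)[OF assms(1)] G_mono[of i J j] True assms by auto
  ultimately show ?thesis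
    using expectation_accepts[OF assms(1)] by simp
next
  case False
  then have "(accepts a b \<and> a \<le> j) = (a \<le> j)" for a b
    by (auto simp: accepts_def)
  moreover have "G i j \<le> accept_prob i"
  proof -
    have "j \<le> J - 1" "J - 1 \<le> m" using False J by auto
    then show ?thesis
      using G_mono[OF assms(1)] accept_prob_bounds(1)[OF assms(1)] by (meson order.trans)
  qed
  moreover have "measure_pmf.expectation (agent_pmf i) (\<lambda>z. of_bool (fst z \<le> j)) = G i j"
    unfolding agent_pmf_def using assms
    by (subst expectation_pair_pmf_fst) (auto simp: expectation_type_le)
  ultimately show ?thesis by simp
qed

text \<open>Exhibits the next agent as independent of the run so far, which is what the recursions
  in \<open>q\<close> rest on.\<close>

lemma run_pmf_Suc:
  "run_pmf (Suc q) = map_pmf (\<lambda>((t, c), (a, b)). (t(Suc q := a), c(Suc q := b)))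
     (pair_pmf (run_pmf q) (agent_pmf (Suc q)))"
proof -
  have interval: "{1..Suc q} = insert (Suc q) {1..q}" by auto
  have "run_pmf (Suc q) =
      map_pmf (\<lambda>((a, t), (b, c)). (t(Suc q := a), c(Suc q := b)))
        (pair_pmf (pair_pmf (type_pmf m G (Suc q)) (types_pmf q m G))
                  (pair_pmf (bernoulli_pmf \<rho>) (coins_pmf q \<rho>)))"
    unfolding run_pmf_def types_pmf_def coins_pmf_def interval
    by (simp add: Pi_pmf_insert map_pair[symmetric] case_prod_unfold)
  also have "\<dots> = map_pmf (\<lambda>((t, c), (a, b)). (t(Suc q := a), c(Suc q := b)))
     (pair_pmf (run_pmf q) (agent_pmf (Suc q)))"
    \<comment> \<open>Both sides make the same four independent draws in different orders.\<close>
    unfolding run_pmf_def agent_pmf_def pair_pmf_def map_pmf_def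
    apply (simp add: bind_assoc_pmf bind_return_pmf)
    apply (subst bind_commute_pmf[of "type_pmf m G (Suc q)"])
    apply (intro bind_pmf_cong refl)
    apply (subst bind_commute_pmf[of "coins_pmf q \<rho>"])
    apply (intro bind_pmf_cong refl)
    apply (rule bind_commute_pmf)
    done
  finally show ?thesis .
qed

section \<open>Slot occupancy and expected acceptances\<close>

lemma accepted_subset: "accepted k J t c q \<subseteq> {1..q}"
  by (induction q) (auto simp: Let_def)

lemma finite_accepted [simp]: "finite (accepted k J t c q)"
  by (rule finite_subset[OF accepted_subset]) simp

lemma accepted_cong:
  assumes "\<And>i. i \<in> {1..q} \<Longrightarrow> t i = t' i \<and> c i = c' i"
  shows "accepted k J t c q = accepted k J t' c' q"
  using assms by (induction q) (auto simp: Let_def)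

lemma accepted_Suc_fun_upd:
  "accepted k J (t(Suc q := a)) (c(Suc q := b)) (Suc q) =
    (if card (accepted k J t c q) < k \<and> accepts a b
     then insert (Suc q) (accepted k J t c q) else accepted k J t c q)"
proof -
  have "accepted k J (t(Suc q := a)) (c(Suc q := b)) q = accepted k J t c q"
    by (rule accepted_cong) auto
  then show ?thesis by (simp add: Let_def accepts_def)
qed

lemma card_accepted_le: "card (accepted k J t c q) \<le> k"
  by (induction q) (use accepted_subset in \<open>auto simp: Let_def card_insert_if\<close>)

text \<open>The shift by one: \<open>slot_prob q l\<close> is the LP variable $x^l_{q+1}$.\<close>

definition slot_prob :: "nat \<Rightarrow> nat \<Rightarrow> real" where
  "slot_prob q l = measure_pmf.expectation (run_pmf q)
     (\<lambda>z. of_bool (card (accepted k J (fst z) (snd z) q) + l = k))"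

definition accepted_upto :: "nat \<Rightarrow> nat \<Rightarrow> real" where
  "accepted_upto q j = measure_pmf.expectation (run_pmf q)
     (\<lambda>z. real (card {i\<in>accepted k J (fst z) (snd z) q. fst z i \<le> j}))"

lemma slot_prob_nonneg: "0 \<le> slot_prob q l"
  unfolding slot_prob_def by (rule integral_nonneg_AE) auto

lemma slot_prob_0: "slot_prob 0 l = of_bool (l = k)"
  by (simp add: slot_prob_def)

text \<open>Matches the convention $y^{k+1}_i = 0$. It holds because \<open>slot_prob\<close> uses
  \<open>card + l = k\<close>; truncated subtraction \<open>k - l\<close> would confuse
  \<open>l > k\<close> with \<open>l = k\<close>.\<close>

lemma slot_prob_gt: "k < l \<Longrightarrow> slot_prob q l = 0"
  by (simp add: slot_prob_def)

lemma expectation_run_Suc: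
  fixes f :: "_ \<Rightarrow> real"
  shows "measure_pmf.expectation (run_pmf (Suc q)) f =
    measure_pmf.expectation (pair_pmf (run_pmf q) (agent_pmf (Suc q)))
      (\<lambda>z. f ((fst (fst z))(Suc q := fst (snd z)), (snd (fst z))(Suc q := snd (snd z))))"
  by (simp add: run_pmf_Suc case_prod_unfold)

lemma card_accepted_Suc:
  "card (accepted k J (t(Suc q := a)) (c(Suc q := b)) (Suc q)) =
    card (accepted k J t c q) + of_bool (card (accepted k J t c q) < k \<and> accepts a b)"
proof -
  have "Suc q \<notin> accepted k J t c q" using accepted_subset[of t c q] by auto
  then show ?thesis by (simp add: accepted_Suc_fun_upd del: accepted.simps)
qed

text \<open>To have \<open>l \<ge> 1\<close> free slots afterwards, there were \<open>l\<close> and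
  the agent was rejected, or \<open>l + 1\<close> and the agent was accepted. Independence gives the
  product form. With \<open>l = 0\<close> this fails, since a full system also stays full when a
  willing acceptance is blocked.\<close>

lemma slot_prob_Suc:
  assumes "q < n" "1 \<le> l"
  shows "slot_prob (Suc q) l =
    slot_prob q l * (1 - accept_prob (Suc q)) + slot_prob q (Suc l) * accept_prob (Suc q)"
proof -
  let ?P = "pair_pmf (run_pmf q) (agent_pmf (Suc q))"
  let ?N = "\<lambda>z l. of_bool (card (accepted k J (fst z) (snd z) q) + l = k) :: real"
  let ?a = "\<lambda>z. of_bool (accepts (fst z) (snd z)) :: real"
  have fin: "finite (set_pmf (run_pmf q))" "finite (set_pmf (agent_pmf (Suc q)))"
    using assms finite_run_pmf finite_agent_pmf by auto
  have "slot_prob (Suc q) l = measure_pmf.expectation ?P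
      (\<lambda>z. ?N (fst z) l * (1 - ?a (snd z)) + ?N (fst z) (Suc l) * ?a (snd z))"
    unfolding slot_prob_def expectation_run_Suc fst_conv snd_conv card_accepted_Suc
    by (intro Bochner_Integration.integral_cong refl) (use assms(2) in auto)
  also have "\<dots> = measure_pmf.expectation ?P (\<lambda>z. ?N (fst z) l * (1 - ?a (snd z))) +
      measure_pmf.expectation ?P (\<lambda>z. ?N (fst z) (Suc l) * ?a (snd z))"
    using fin by (intro Bochner_Integration.integral_add integrable_measure_pmf_finite) auto
  also have "\<dots> = slot_prob q l * (1 - accept_prob (Suc q)) + slot_prob q (Suc l) * accept_prob (Suc q)"
    using assms fin expectation_accepts[of "Suc q"]
    unfolding expectation_pair_pmf_mult[OF fin, of "\<lambda>z. ?N z l" "\<lambda>z. 1 - ?a z"]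
      expectation_pair_pmf_mult[OF fin, of "\<lambda>z. ?N z (Suc l)" ?a] slot_prob_def
    by (simp add: integrable_measure_pmf_finite)
  finally show ?thesis .
qed

text \<open>The count grows exactly when a slot is free and the new agent is acceptable with type at
  most \<open>j\<close>. These events are independent; the first is split by the number
  \<open>l\<close> of free slots.\<close>

lemma accepted_upto_Suc:
  assumes "q < n" "j \<in> {1..m}"
  shows "accepted_upto (Suc q) j =
    accepted_upto q j + (\<Sum>l = 1..k. slot_prob q l) * min (accept_prob (Suc q)) (G (Suc q) j)"
proof -
  let ?P = "pair_pmf (run_pmf q) (agent_pmf (Suc q))"
  let ?C = "\<lambda>z. real (card {i\<in>accepted k J (fst z) (snd z) q. fst z i \<le> j})"
  let ?N = "\<lambda>z. \<Sum>l = 1..k. of_bool (card (accepted k J (fst z) (snd z) q) + l = k) :: real"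
  let ?a = "\<lambda>z. of_bool (accepts (fst z) (snd z) \<and> fst z \<le> j) :: real"
  have fin: "finite (set_pmf (run_pmf q))" "finite (set_pmf (agent_pmf (Suc q)))"
    using assms finite_run_pmf finite_agent_pmf by auto
  have step: "real (card {i \<in> accepted k J (t(Suc q := a)) (c(Suc q := b)) (Suc q). (t(Suc q := a)) i \<le> j}) =
      ?C (t, c) + ?N (t, c) * ?a (a, b)" for t c a b
  proof -
    let ?A = "accepted k J t c q"
    have "Suc q \<notin> ?A" using accepted_subset[of t c q] by auto
    then have eq: "{i\<in>?A. (t(Suc q := a)) i \<le> j} = {i\<in>?A. t i \<le> j}"
      "Suc q \<notin> {i\<in>?A. t i \<le> j}" by auto
    \<comment> \<open>The only candidate is \<open>l = k - card ?A\<close>, and it lies in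
      \<open>{1..k}\<close> exactly when a slot is free.\<close>
    have "(\<Sum>l = 1..k. of_bool (card ?A + l = k)) = (\<Sum>l = 1..k. of_bool (l = k - card ?A) :: real)"
      using card_accepted_le[of t c q] by (intro sum.cong) auto
    also have "\<dots> = of_bool (card ?A < k)"
      by (auto simp: of_bool_def)
    finally have N: "(\<Sum>l = 1..k. of_bool (card ?A + l = k)) = (of_bool (card ?A < k) :: real)" .
    have ins: "{i\<in>insert (Suc q) ?A. (t(Suc q := a)) i \<le> j} =
      (if a \<le> j then insert (Suc q) {i\<in>?A. t i \<le> j} else {i\<in>?A. t i \<le> j})"
      using eq \<open>Suc q \<notin> ?A\<close> by auto
    have card_ins: "card (insert (Suc q) {i\<in>?A. t i \<le> j}) = Suc (card {i\<in>?A. t i \<le> j})"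
      using eq(2) by (intro card_insert_disjoint) auto
    show ?thesis
      unfolding accepted_Suc_fun_upd fst_conv snd_conv N
      by (cases "card ?A < k"; cases "accepts a b"; cases "a \<le> j")
         (simp_all only: ins eq if_True if_False simp_thms of_bool_eq, simp_all add: card_ins)
  qed
  have "accepted_upto (Suc q) j = measure_pmf.expectation ?P (\<lambda>z. ?C (fst z) + ?N (fst z) * ?a (snd z))"
    unfolding accepted_upto_def expectation_run_Suc
  proof (rule Bochner_Integration.integral_cong[OF refl], goal_cases)
    case (1 z)
    obtain t c a b where z: "z = ((t, c), (a, b))" 
      by (cases z, cases "fst z", cases "snd z") auto
    show ?case
      unfolding z fst_conv snd_conv by (rule step[unfolded fst_conv snd_conv])
  qed
  also have "\<dots> = measure_pmf.expectation ?P (\<lambda>z. ?C (fst z)) +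
      measure_pmf.expectation ?P (\<lambda>z. ?N (fst z) * ?a (snd z))"
    using fin by (intro Bochner_Integration.integral_add integrable_measure_pmf_finite) auto
  also have "measure_pmf.expectation ?P (\<lambda>z. ?C (fst z)) = accepted_upto q j"
    unfolding accepted_upto_def by (rule expectation_pair_pmf_fst[where f = ?C])
  also have "measure_pmf.expectation ?P (\<lambda>z. ?N (fst z) * ?a (snd z)) =
      measure_pmf.expectation (run_pmf q) ?N * measure_pmf.expectation (agent_pmf (Suc q)) ?a"
    by (rule expectation_pair_pmf_mult[OF fin, of ?N ?a])
  also have "measure_pmf.expectation (agent_pmf (Suc q)) ?a = min (accept_prob (Suc q)) (G (Suc q) j)"
    using assms by (intro expectation_accepts_le) auto
  also have "measure_pmf.expectation (run_pmf q) ?N = (\<Sum>l = 1..k. slot_prob q l)"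
    unfolding slot_prob_def
    using fin by (intro Bochner_Integration.integral_sum integrable_measure_pmf_finite) auto
  finally show ?thesis .
qed

text \<open>Summing the one-agent increments gives the right-hand side of the \<open>j\<close>-th LP
  constraint; nonnegativity of \<open>slot_prob\<close> allows it to be moved inside the
  minimum.\<close>

lemma accepted_upto_eq_sum:
  assumes "q \<le> n" "j \<in> {1..m}"
  shows "accepted_upto q j =
    (\<Sum>i = 1..q. \<Sum>l = 1..k. min (accept_prob i * slot_prob (i - 1) l) (G i j * slot_prob (i - 1) l))"
  using assms(1)
proof (induction q)
  case 0
  show ?case by (simp add: accepted_upto_def)
next
  case (Suc q)
  have "(\<Sum>l = 1..k. slot_prob q l) * min (accept_prob (Suc q)) (G (Suc q) j) =
      (\<Sum>l = 1..k. min (accept_prob (Suc q) * slot_prob q l) (G (Suc q) j * slot_prob q l))"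
    unfolding sum_distrib_right
    by (intro sum.cong refl) (simp add: min_mult_distrib_left slot_prob_nonneg mult.commute)
  then show ?case
    using Suc assms(2) accepted_upto_Suc[of q j] by simp
qed

lemma accepted_upto_nonneg: "0 \<le> accepted_upto q j"
  unfolding accepted_upto_def by (rule integral_nonneg_AE) auto

text \<open>Abel summation in each run of the support, followed by linearity of expectation.\<close>

lemma ALG_eq: "ALG k n m G J \<rho> r = (\<Sum>j = 1..m. value_step m r j * accepted_upto n j)"
proof -
  have "ALG k n m G J \<rho> r = measure_pmf.expectation (run_pmf n)
     (\<lambda>z. \<Sum>j = 1..m. value_step m r j * real (card {i\<in>accepted k J (fst z) (snd z) n. fst z i \<le> j}))"
    unfolding ALG_def run_pmf_def[symmetric] case_prod_unfold
  proof (intro integral_cong_AE AE_pmfI)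
    fix z assume "z \<in> set_pmf (run_pmf n)"
    then have "fst z \<in> set_pmf (types_pmf n m G)" by (auto simp: run_pmf_def)
    then have "\<And>i. i \<in> accepted k J (fst z) (snd z) n \<Longrightarrow> fst z i \<in> {1..m}"
      using types_pmf_range accepted_subset by blast
    then show "(\<Sum>i\<in>accepted k J (fst z) (snd z) n. r (fst z i)) =
      (\<Sum>j = 1..m. value_step m r j * real (card {i\<in>accepted k J (fst z) (snd z) n. fst z i \<le> j}))"
      by (intro sum_value_eq_card) auto
  qed auto
  also have "\<dots> = (\<Sum>j = 1..m. value_step m r j * accepted_upto n j)"
    unfolding accepted_upto_def using finite_run_pmf[of n]
    by (subst Bochner_Integration.integral_sum) (auto simp: integrable_measure_pmf_finite)
  finally show ?thesis .
qed

section \<open>The forced solution of the inner LP\<close>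

text \<open>The equality constraint makes \<open>y\<close> a multiple of \<open>x\<close>, so the
  flow equations determine \<open>x\<close> agent by agent from its first row, by the same recursion
  as \<open>slot_prob\<close>.\<close>

lemma innerLP_feasible_unique:
  assumes feas: "innerLP_feasible Q k n m G J \<rho> \<theta> x y" and "i \<in> {1..n}" "l \<in> {1..k}"
  shows "x i l = slot_prob (i - 1) l" "y i l = accept_prob i * slot_prob (i - 1) l"
proof -
  have y: "y i l = accept_prob i * x i l" if "i \<in> {1..n}" "l \<in> {1..k}" for i l
    using that feas by (auto simp: innerLP_feasible_def accept_prob_def)
  have "\<forall>l\<in>{1..k}. x (Suc q) l = slot_prob q l" if "q < n" for q
    using that
  proof (induction q)
    case 0
    then show ?case using feas by (auto simp: innerLP_feasible_def slot_prob_0)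
  next
    case (Suc q)
    then have IH: "\<forall>l\<in>{1..k}. x (Suc q) l = slot_prob q l" by simp
    show ?case
    proof
      fix l assume l: "l \<in> {1..k}"
      have "\<forall>i\<in>{2..n}. \<forall>l\<in>{1..k}.
        x i l = x (i - 1) l - y (i - 1) l + (if l < k then y (i - 1) (l + 1) else 0)"
        using feas by (simp add: innerLP_feasible_def)
      from this[rule_format, of "Suc (Suc q)" l]
      have "x (Suc (Suc q)) l = x (Suc q) l - y (Suc q) l + (if l < k then y (Suc q) (l + 1) else 0)"
        using l Suc.prems by simp
      \<comment> \<open>At \<open>l = k\<close> the LP has no inflow from above, in agreement with
        \<open>slot_prob_gt\<close>.\<close>
      then show "x (Suc (Suc q)) l = slot_prob (Suc q) l"
        using l IH Suc.prems
        by (cases "l < k") (simp_all add: y slot_prob_Suc slot_prob_gt algebra_simps)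
    qed
  qed
  moreover have "i - 1 < n" "Suc (i - 1) = i" using assms(2) by auto
  ultimately show x: "x i l = slot_prob (i - 1) l" using assms(3) by metis
  show "y i l = accept_prob i * slot_prob (i - 1) l"
    using y[OF assms(2,3)] x by simp
qed

lemma innerLP_feasible_iff:
  assumes "1 \<le> k"
  shows "(\<exists>x y. innerLP_feasible Q k n m G J \<rho> \<theta> x y) \<longleftrightarrow>
    (\<forall>j\<in>{1..m}. \<theta> * Q k n G j \<le> accepted_upto n j)"
proof
  assume "\<exists>x y. innerLP_feasible Q k n m G J \<rho> \<theta> x y"
  then obtain x y where feas: "innerLP_feasible Q k n m G J \<rho> \<theta> x y" by auto
  have "(\<Sum>i = 1..n. \<Sum>l = 1..k. min (y i l) (G i j * x i l)) = accepted_upto n j"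
    if "j \<in> {1..m}" for j
    unfolding accepted_upto_eq_sum[OF order.refl that]
    by (intro sum.cong refl) (simp add: innerLP_feasible_unique[OF feas])
  then show "\<forall>j\<in>{1..m}. \<theta> * Q k n G j \<le> accepted_upto n j"
    using feas by (auto simp: innerLP_feasible_def)
next
  assume \<theta>: "\<forall>j\<in>{1..m}. \<theta> * Q k n G j \<le> accepted_upto n j"
  have "accept_prob i * slot_prob (i - 1) l \<le> slot_prob (i - 1) l" if "i \<in> {1..n}" for i l
    using mult_right_mono[OF accept_prob_le_1[OF that] slot_prob_nonneg] by simp
  moreover have "slot_prob (i - 1) l = slot_prob (i - 1 - 1) l - accept_prob (i - 1) * slot_prob (i - 1 - 1) l +
      (if l < k then accept_prob (i - 1) * slot_prob (i - 1 - 1) (l + 1) else 0)"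
    if "i \<in> {2..n}" "l \<in> {1..k}" for i l
  proof -
    \<comment> \<open>Since \<open>i \<ge> 2\<close>, agent \<open>i\<close> has a predecessor and
      the repeated subtraction is exact.\<close>
    have "Suc (i - 1 - 1) = i - 1" using that by auto
    then show ?thesis
      using slot_prob_Suc[of "i - 1 - 1" l] that
      by (auto simp: slot_prob_gt algebra_simps)
  qed
  ultimately have "innerLP_feasible Q k n m G J \<rho> \<theta> (\<lambda>i. slot_prob (i - 1))
      (\<lambda>i l. accept_prob i * slot_prob (i - 1) l)"
    using \<theta> unfolding innerLP_feasible_def
    by (auto simp: accepted_upto_eq_sum[symmetric] slot_prob_0 slot_prob_nonneg accept_prob_nonneg
      accept_prob_def[symmetric] simp del: One_nat_def)
  then show "\<exists>x y. innerLP_feasible Q k n m G J \<rho> \<theta> x y" by blast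
qed

section \<open>The worst valuation and the two guarantees\<close>

text \<open>An abstract pair \<open>B\<close>, \<open>Q\<close> lets one argument serve both
  benchmarks. \<open>Q_pos\<close> ensures that the minimum defining \<open>\<theta>\<close> ranges
  over a nonempty set.\<close>

lemma INF_ratio_eq_innerLP:
  assumes "1 \<le> k"
    and B: "\<And>r. valuation m r \<Longrightarrow> B k n m G r = (\<Sum>j = 1..m. value_step m r j * Q k n G j)"
    and Q_nonneg: "\<And>j. j \<in> {1..m} \<Longrightarrow> 0 \<le> Q k n G j"
    and Q_pos: "0 < Q k n G m"
  shows "(INF r\<in>{r. valuation m r \<and> 0 < B k n m G r}. ereal (ALG k n m G J \<rho> r / B k n m G r)) =
    innerLP Q k n m G J \<rho>"
proof (rule antisym)
  show "innerLP Q k n m G J \<rho> \<le>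
    (INF r\<in>{r. valuation m r \<and> 0 < B k n m G r}. ereal (ALG k n m G J \<rho> r / B k n m G r))"
    unfolding innerLP_def innerLP_feasible_iff[OF assms(1)]
  proof (rule SUP_least, rule INF_greatest, clarsimp)
    fix \<theta> r
    assume \<theta>: "\<forall>j\<in>{Suc 0..m}. \<theta> * Q k n G j \<le> accepted_upto n j"
      and r: "valuation m r" "0 < B k n m G r"
    have "\<theta> * B k n m G r = (\<Sum>j = 1..m. value_step m r j * (\<theta> * Q k n G j))"
      unfolding B[OF r(1)] by (simp add: sum_distrib_left mult_ac)
    also have "\<dots> \<le> ALG k n m G J \<rho> r"
      unfolding ALG_eq using \<theta> value_step_nonneg[OF r(1)] by (intro sum_mono mult_left_mono) auto
    finally show "\<theta> \<le> ALG k n m G J \<rho> r / B k n m G r"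
      using r(2) by (simp add: pos_le_divide_eq)
  qed
  \<comment> \<open>Indices outside \<open>P\<close> leave \<open>\<theta>\<close> unconstrained:
    there the constraint says only that \<open>accepted_upto\<close> is nonnegative.\<close>
  define P where "P = {j\<in>{1..m}. 0 < Q k n G j}"
  have P: "finite P" "P \<noteq> {}"
    using Q_pos types_pos by (auto simp: P_def)
  define \<theta> where "\<theta> = Min ((\<lambda>j. accepted_upto n j / Q k n G j) ` P)"
  have "\<theta> \<in> (\<lambda>j. accepted_upto n j / Q k n G j) ` P"
    unfolding \<theta>_def using P by (intro Min_in) auto
  then obtain q where q: "q \<in> P" "\<theta> = accepted_upto n q / Q k n G q"
    by auto
  have "\<theta> * Q k n G j \<le> accepted_upto n j" if "j \<in> {1..m}" for j
  proof (cases "j \<in> P")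
    case True
    then have "\<theta> \<le> accepted_upto n j / Q k n G j"
      unfolding \<theta>_def using P by (intro Min_le) auto
    with True show ?thesis by (simp add: P_def pos_le_divide_eq)
  next
    case False
    then have "Q k n G j = 0" using that Q_nonneg[OF that] by (simp add: P_def)
    then show ?thesis using accepted_upto_nonneg by simp
  qed
  then have le: "ereal \<theta> \<le> innerLP Q k n m G J \<rho>"
    unfolding innerLP_def innerLP_feasible_iff[OF assms(1)] by (intro SUP_upper) auto
  \<comment> \<open>The only nonzero step of this valuation is at the minimizing index
    \<open>q\<close>, so its ratio is exactly \<open>\<theta>\<close>.\<close>
  define r :: "nat \<Rightarrow> real" where "r j = of_bool (j \<le> q)" for j
  have q': "q \<in> {1..m}" using q by (simp add: P_def)
  have r: "valuation m r" using q' by (auto simp: valuation_def r_def intro!: bexI[of _ q])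
  have "value_step m r j = of_bool (j = q)" if "j \<in> {1..m}" for j
    using q' that by (auto simp: value_step_def r_def)
  then have "(\<Sum>j = 1..m. value_step m r j * f j) = (\<Sum>j = 1..m. if j = q then f j else 0)" for f
    by (intro sum.cong) auto
  then have "(\<Sum>j = 1..m. value_step m r j * f j) = f q" for f
    using q' by simp
  then have "ALG k n m G J \<rho> r = accepted_upto n q" "B k n m G r = Q k n G q"
    unfolding ALG_eq B[OF r] by auto
  with r q have "(INF r\<in>{r. valuation m r \<and> 0 < B k n m G r}.
      ereal (ALG k n m G J \<rho> r / B k n m G r)) \<le> ereal \<theta>"
    by (intro INF_lower2[of r]) (auto simp: P_def)
  with le show "(INF r\<in>{r. valuation m r \<and> 0 < B k n m G r}.
      ereal (ALG k n m G J \<rho> r / B k n m G r)) \<le> innerLP Q k n m G J \<rho>"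
    by simp
qed

end

lemma OST_guarantee_eq:
  assumes "1 \<le> k"
    and "\<And>m G r. type_distribution n m G \<Longrightarrow> valuation m r \<Longrightarrow>
      B k n m G r = (\<Sum>j = 1..m. value_step m r j * Q k n G j)"
    and "\<And>m G j. type_distribution n m G \<Longrightarrow> j \<in> {1..m} \<Longrightarrow> 0 \<le> Q k n G j"
    and "\<And>m G. type_distribution n m G \<Longrightarrow> 0 < Q k n G m"
  shows "OST_guarantee B k n =
    (INF (m, G)\<in>{(m, G). type_distribution n m G}.
       SUP (J, \<rho>)\<in>{1..m} \<times> {0<..1}. innerLP Q k n m G J \<rho>)"
  unfolding OST_guarantee_def
proof (intro INF_cong refl, clarify, intro SUP_cong refl, clarify)
  fix m G J and \<rho> :: real
  assume G: "type_distribution n m G" and "J \<in> {1..m}" "\<rho> \<in> {0<..1}"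
  then interpret threshold_policy n m G k J \<rho>
    by unfold_locales
  show "(INF r\<in>{r. valuation m r \<and> 0 < B k n m G r}. ereal (ALG k n m G J \<rho> r / B k n m G r)) =
    innerLP Q k n m G J \<rho>"
    using assms G by (intro INF_ratio_eq_innerLP) auto
qed

theorem theorem2:
  fixes k n :: nat
  assumes "1 \<le> k" and "k < n"
  shows "OST_guarantee Proph k n =
           (INF (m, G)\<in>{(m, G). type_distribution n m G}.
              SUP (J, \<rho>)\<in>{1..m} \<times> {0<..1}. innerLP Q_Proph k n m G J \<rho>) \<and>
         OST_guarantee ExAnte k n =
           (INF (m, G)\<in>{(m, G). type_distribution n m G}.
              SUP (J, \<rho>)\<in>{1..m} \<times> {0<..1}. innerLP Q_ExAnte k n m G J \<rho>)"
proof
  show "OST_guarantee Proph k n =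
      (INF (m, G)\<in>{(m, G). type_distribution n m G}.
         SUP (J, \<rho>)\<in>{1..m} \<times> {0<..1}. innerLP Q_Proph k n m G J \<rho>)"
  proof (rule OST_guarantee_eq)
    fix m G assume "type_distribution n m G"
    then interpret typed_agents n m G
      by unfold_locales
    show "Proph k n m G r = (\<Sum>j = 1..m. value_step m r j * Q_Proph k n G j)" if "valuation m r" for r
      using that by (rule Proph_eq)
    show "0 \<le> Q_Proph k n G j" if "j \<in> {1..m}" for j
      using that unfolding Q_Proph_def by (intro integral_nonneg_AE) (auto intro: sum_nonneg)
    \<comment> \<open>All \<open>n > k\<close> agents have type at most \<open>m\<close>, so the
      capped count is always \<open>k\<close>.\<close>
    have "Q_Proph k n G m = measure_pmf.expectation (types_pmf n m G) (\<lambda>t. real k)"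
      unfolding Q_Proph_eq[OF order.refl]
    proof (intro integral_cong_AE AE_pmfI)
      fix t assume "t \<in> set_pmf (types_pmf n m G)"
      then have "{i\<in>{1..n}. t i \<le> m} = {1..n}" using types_pmf_range[of t n] by auto
      then show "real (min (card {i\<in>{1..n}. t i \<le> m}) k) = real k" using assms by simp
    qed auto
    then show "0 < Q_Proph k n G m" using assms by simp
  qed (fact assms)
  show "OST_guarantee ExAnte k n =
      (INF (m, G)\<in>{(m, G). type_distribution n m G}.
         SUP (J, \<rho>)\<in>{1..m} \<times> {0<..1}. innerLP Q_ExAnte k n m G J \<rho>)"
  proof (rule OST_guarantee_eq)
    fix m G assume "type_distribution n m G"
    then interpret typed_agents n m G
      by unfold_locales
    show "ExAnte k n m G r = (\<Sum>j = 1..m. value_step m r j * Q_ExAnte k n G j)" if "valuation m r" for r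
      using that by (rule ExAnte_eq)
    show "0 \<le> Q_ExAnte k n G j" if "j \<in> {1..m}" for j
      using that by (auto simp: Q_ExAnte_def intro!: sum_nonneg G_nonneg)
    show "0 < Q_ExAnte k n G m" using assms by (simp add: Q_ExAnte_def G_m)
  qed (fact assms)
qed

end
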